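(* For every integer $n\ge 0$, the number of separable signed permutations in $B_n$, $\#K(B_n)$, equals the $n$th (large) Schröder number.
   Context: $B_n$ is the group of signed permutations: bijections $w$ of $\{\pm1,\dots,\pm n\}$ with $w(-i)=-w(i)$, written $w=w_1\cdots w_n$, $w_i=w(i)$; $\bar a=-a$; $B_0$ consists of the empty signed permutation. For a word $a=a_1\cdots a_m$ of nonzero integers with distinct absolute values, $\mathrm{sts}(a)\in B_m$ is the signed permutation whose $i$-th entry has the sign of $a_i$ and whose absolute values have the same relative order as $|a_1|,\dots,|a_m|$. $w\in B_n$ contains the pattern $u\in B_m$ if $\mathrm{sts}(w_{i_1}\cdots w_{i_m})=u$ for some $i_1<\cdots<i_m$; otherwise it avoids $u$. $K(B_n)$ is the set of separable $w\in B_n$, i.e. those avoiding $\bar21$, $2\bar1$, $3142$, $2413$, $\bar3\,\bar1\,\bar4\,\bar2$, $\bar2\,\bar4\,\bar1\,\bar3$. The large Schröder numbers $r_0,r_1,r_2,\dots=1,2,6,22,90,394,1806,\dots$ are given by $r_0=1$ and $r_n=r_{n-1}+\sum_{k=0}^{n-1}r_kr_{n-1-k}$ for $n\ge1$. *)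

theory Defs
  imports Main "HOL-Library.Sublist" "HOL-Combinatorics.Permutations"
begin

text \<open>An element of the group of signed permutations is a function on all of \<^typ>\<open>int\<close>; it is the
  identity outside $\{\pm 1, \dots, \pm n\}$ (this is part of \<^const>\<open>permutes\<close>), so distinct functions
  are distinct signed permutations.\<close>

definition signed_perms :: "nat \<Rightarrow> (int \<Rightarrow> int) set" where
  "signed_perms n = {w. w permutes {i. i \<noteq> 0 \<and> \<bar>i\<bar> \<le> int n} \<and> (\<forall>i. w (- i) = - w i)}"

definition one_line :: "nat \<Rightarrow> (int \<Rightarrow> int) \<Rightarrow> int list" where
  "one_line n w = map w [1..int n]"

text \<open>The one-line notation of the standardization of a word of nonzero integers with distinct absolute
  values: each letter keeps its sign, and its absolute value is replaced by its rank among the absolute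
  values of all letters.\<close>

definition sts :: "int list \<Rightarrow> int list" where
  "sts a = map (\<lambda>x. sgn x * int (card {y \<in> set a. \<bar>y\<bar> \<le> \<bar>x\<bar>})) a"

text \<open>Patterns are given in one-line notation.\<close>

definition contains_pattern :: "nat \<Rightarrow> (int \<Rightarrow> int) \<Rightarrow> int list \<Rightarrow> bool" where
  "contains_pattern n w u \<longleftrightarrow> (\<exists>a. subseq a (one_line n w) \<and> sts a = u)"

definition separable_signed_perms :: "nat \<Rightarrow> (int \<Rightarrow> int) set" where
  "separable_signed_perms n =
     {w \<in> signed_perms n.
        \<forall>u \<in> {[-2, 1], [2, -1], [3, 1, 4, 2], [2, 4, 1, 3], [-3, -1, -4, -2], [-2, -4, -1, -3]}.
          \<not> contains_pattern n w u}"

context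
  notes sum.cong [fundef_cong]
begin

fun large_schroeder :: "nat \<Rightarrow> nat" where
  "large_schroeder 0 = 1"
| "large_schroeder (Suc n) =
     large_schroeder n + (\<Sum>k = 0..n. large_schroeder k * large_schroeder (n - k))"

end

lemma "map large_schroeder [0..<7] = [1, 2, 6, 22, 90, 394, 1806]"
  by code_simp

end

theory Submission
  imports Defs
begin

text \<open>
  Avoiding $\bar 2 1$ and $2 \bar 1$ means that the two letters of every inversion of $|w|$ have equal
  signs, that is, that the signs are constant on each indecomposable block of $|w|$. The other four
  patterns then say that $|w|$ avoids $3142$ and $2413$.

  Let $a_n$ be the number of permutations avoiding $3142$ and $2413$, $i_n$ the number of the
  indecomposable ones, and $k_n = \# K(B_n)$. Splitting off the first block gives
  $a_n = \sum_{j=1}^n i_j a_{n-j}$ and $k_n = \sum_{j=1}^n 2 i_j k_{n-j}$. Each permutation of length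
  $n \ge 2$ avoiding both patterns is either a direct sum or a skew sum, but not both, and reversal
  exchanges the two kinds; hence $a_n = 2 i_n$. So $a_{n+1} = \sum_{j=1}^n 2 i_j a_{n+1-j}$, and
  induction yields $k_n = a_{n+1}$. Finally, $2 i_1 = 2 = k_0 + 1$ and $2 i_{j+1} = a_{j+1} = k_j$
  for $j \ge 1$ turn the recurrence for $k_n$ into that of the large Schroeder numbers.
\<close>

section \<open>Pattern avoidance and sum decompositions of words under an integer key\<close>

text \<open>Words are compared through a key \<^term>\<open>f :: 'a \<Rightarrow> int\<close>: the key \<^term>\<open>abs :: int \<Rightarrow> int\<close> treats
  the permutation $|w|$, and negating the key exchanges direct sums and skew sums. The two excluded
  orders are $3142$ and $2413$.\<close>

definition avoids :: "('a \<Rightarrow> int) \<Rightarrow> 'a list \<Rightarrow> bool" where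
  "avoids f xs \<longleftrightarrow> (\<forall>a b c d. subseq [a, b, c, d] xs \<longrightarrow>
     \<not> (f b < f d \<and> f d < f a \<and> f a < f c) \<and> \<not> (f c < f a \<and> f a < f d \<and> f d < f b))"

text \<open>A direct sum of two nonempty words in the sense of \<open>f\<close>; for the negated key
  the same formula describes a skew sum.\<close>

definition decomposable :: "('a \<Rightarrow> int) \<Rightarrow> 'a list \<Rightarrow> bool" where
  "decomposable f xs \<longleftrightarrow>
     (\<exists>as bs. xs = as @ bs \<and> as \<noteq> [] \<and> bs \<noteq> [] \<and> (\<forall>a\<in>set as. \<forall>b\<in>set bs. f a < f b))"

lemma decomposableI:
  assumes "as \<noteq> []" "bs \<noteq> []" "\<And>a b. a \<in> set as \<Longrightarrow> b \<in> set bs \<Longrightarrow> f a < f b"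
  shows "decomposable f (as @ bs)"
  using assms unfolding decomposable_def by blast

lemma decomposableE:
  assumes "decomposable f xs"
  obtains as bs where "xs = as @ bs" "as \<noteq> []" "bs \<noteq> []"
    "\<And>a b. a \<in> set as \<Longrightarrow> b \<in> set bs \<Longrightarrow> f a < f b"
  using assms unfolding decomposable_def by blast

lemma subseq_map_obtain:
  assumes "subseq ys (map g xs)"
  obtains zs where "ys = map g zs" "subseq zs xs"
  using assms by (auto simp: subseq_conv_nths nths_map)

lemma subseq_set: "subseq ys xs \<Longrightarrow> set ys \<subseteq> set xs"
  by (auto dest: list_emb_set)

lemma avoids_map: "avoids f (map g xs) \<longleftrightarrow> avoids (\<lambda>x. f (g x)) xs"
proof
  assume L: "avoids f (map g xs)"
  show "avoids (\<lambda>x. f (g x)) xs"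
    unfolding avoids_def
  proof (intro allI impI)
    fix a b c d assume "subseq [a, b, c, d] xs"
    then have "subseq [g a, g b, g c, g d] (map g xs)"
      using subseq_map[of "[a, b, c, d]" xs g] by simp
    with L show "\<not> (f (g b) < f (g d) \<and> f (g d) < f (g a) \<and> f (g a) < f (g c)) \<and>
        \<not> (f (g c) < f (g a) \<and> f (g a) < f (g d) \<and> f (g d) < f (g b))"
      unfolding avoids_def by blast
  qed
next
  assume R: "avoids (\<lambda>x. f (g x)) xs"
  show "avoids f (map g xs)"
    unfolding avoids_def
  proof (intro allI impI)
    fix a b c d assume "subseq [a, b, c, d] (map g xs)"
    then obtain zs where "[a, b, c, d] = map g zs" "subseq zs xs"
      by (rule subseq_map_obtain)
    then obtain a' b' c' d' where "subseq [a', b', c', d'] xs"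
      "a = g a'" "b = g b'" "c = g c'" "d = g d'"
      by (auto simp: Cons_eq_map_conv)
    with R show "\<not> (f b < f d \<and> f d < f a \<and> f a < f c) \<and> \<not> (f c < f a \<and> f a < f d \<and> f d < f b)"
      unfolding avoids_def by blast
  qed
qed

lemma avoids_cong_order:
  assumes "\<And>x y. x \<in> set xs \<Longrightarrow> y \<in> set xs \<Longrightarrow> f x < f y \<longleftrightarrow> g x < g y"
  shows "avoids f xs \<longleftrightarrow> avoids g xs"
proof -
  have "a \<in> set xs \<and> b \<in> set xs \<and> c \<in> set xs \<and> d \<in> set xs" if "subseq [a, b, c, d] xs" for a b c d
    using subseq_set[OF that] by auto
  then show ?thesis
    unfolding avoids_def by (intro iff_allI imp_cong refl) (simp add: assms)
qed

text \<open>Negating the key complements each order, and the complement of 3142 is 2413.\<close>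

lemma avoids_uminus: "avoids (\<lambda>x. - f x) xs \<longleftrightarrow> avoids f xs"
  unfolding avoids_def by auto

lemma subseq_rev: "subseq xs ys \<Longrightarrow> subseq (rev xs) (rev ys)"
  by (induction rule: list_emb.induct) (auto intro: list_emb_append_mono subseq_rev_drop_many)

text \<open>3142 read backwards is 2413.\<close>

lemma avoids_rev: "avoids f (rev xs) \<longleftrightarrow> avoids f xs"
proof -
  have "avoids f (rev xs)" if "avoids f xs" for xs :: "'a list"
    unfolding avoids_def
  proof (intro allI impI)
    fix a b c d assume "subseq [a, b, c, d] (rev xs)"
    then have "subseq [d, c, b, a] xs"
      using subseq_rev[of "[a, b, c, d]" "rev xs"] by simp
    with that show "\<not> (f b < f d \<and> f d < f a \<and> f a < f c) \<and> \<not> (f c < f a \<and> f a < f d \<and> f d < f b)"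
      unfolding avoids_def by blast
  qed
  from this[of xs] this[of "rev xs"] show ?thesis by auto
qed

lemma avoids_subseq: "avoids f xs \<Longrightarrow> subseq ys xs \<Longrightarrow> avoids f ys"
  unfolding avoids_def by (meson subseq_order.trans)

text \<open>Both excluded orders are indecomposable: wherever 3142 or 2413 is cut in two, some
  letter before the cut exceeds one after it. So no occurrence straddles the boundary between
  \<open>as\<close> and \<open>bs\<close>.\<close>

lemma avoids_append:
  assumes less: "\<And>a b. a \<in> set as \<Longrightarrow> b \<in> set bs \<Longrightarrow> f a < f b"
  shows "avoids f (as @ bs) \<longleftrightarrow> avoids f as \<and> avoids f bs"
proof
  assume "avoids f (as @ bs)"
  then show "avoids f as \<and> avoids f bs"
    by (meson avoids_subseq list_emb_append2 prefix_imp_subseq prefixI subseq_order.refl)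
next
  assume *: "avoids f as \<and> avoids f bs"
  show "avoids f (as @ bs)"
    unfolding avoids_def
  proof (intro allI impI)
    fix a b c d assume "subseq [a, b, c, d] (as @ bs)"
    then obtain us vs where uv: "[a, b, c, d] = us @ vs" "subseq us as" "subseq vs bs"
      by (auto simp: subseq_append_iff)
    have less': "f u < f v" if "u \<in> set us" "v \<in> set vs" for u v
      using less that subseq_set uv(2,3) by blast
    show "\<not> (f b < f d \<and> f d < f a \<and> f a < f c) \<and> \<not> (f c < f a \<and> f a < f d \<and> f d < f b)"
    proof (cases "us = [] \<or> vs = []")
      case True
      then show ?thesis using uv * unfolding avoids_def by auto
    next
      case False
      from uv(1) show ?thesis
        using False less' by (auto simp: Cons_eq_append_conv) force+
    qed
  qed
qed

section \<open>Avoiding words of length at least 2 are direct sums or skew sums\<close>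

text \<open>Take the shortest first summand \<open>as\<close> and compare it with the new last
  letter \<open>v\<close>. If \<open>v\<close> lies above all of \<open>as\<close>, it joins the
  second summand; if below, it lies below the whole word and gives a skew sum. Otherwise minimality
  of \<open>as\<close> produces an occurrence of 3142 that ends in \<open>v\<close>.\<close>

lemma decomposable_snoc:
  assumes dec: "decomposable f xs" and avoids: "avoids f (xs @ [v])"
    and inj: "\<And>x. x \<in> set xs \<Longrightarrow> f x \<noteq> f v"
  shows "decomposable f (xs @ [v]) \<or> decomposable (\<lambda>x. - f x) (xs @ [v])"
proof -
  define split where "split = (\<lambda>as bs. xs = as @ bs \<and> as \<noteq> [] \<and> bs \<noteq> [] \<and>
    (\<forall>a\<in>set as. \<forall>b\<in>set bs. f a < f b))"
  have "\<exists>as. \<exists>bs. split as bs"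
    using dec unfolding decomposable_def split_def by blast
  then obtain as where "\<exists>bs. split as bs"
    and min: "\<And>as'. \<exists>bs. split as' bs \<Longrightarrow> length as \<le> length as'"
    by (metis (no_types, lifting) ex_has_least_nat[of "\<lambda>as. \<exists>bs. split as bs" _ length])
  then obtain bs where s: "split as bs" by blast
  then have xs: "xs = as @ bs" and ne: "as \<noteq> []" "bs \<noteq> []"
    and less: "\<And>a b. a \<in> set as \<Longrightarrow> b \<in> set bs \<Longrightarrow> f a < f b"
    unfolding split_def by auto
  consider "\<forall>a\<in>set as. f a < f v" | "\<forall>a\<in>set as. f v < f a"
    | h l where "h \<in> set as" "l \<in> set as" "f l < f v" "f v < f h"
    using inj xs by (metis UnCI linorder_neqE set_append)
  then show ?thesis
  proof cases
    case 1
    then have "decomposable f (as @ (bs @ [v]))"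
      using ne less by (intro decomposableI) auto
    then show ?thesis by (simp add: xs)
  next
    case 2
    have "f v < f x" if "x \<in> set xs" for x
      using that 2 less ne(1) unfolding xs by (cases as) force+
    then have "decomposable (\<lambda>x. - f x) (xs @ [v])"
      using ne xs by (intro decomposableI) auto
    then show ?thesis ..
  next
    case 3
    \<comment> \<open>\<open>as\<close> is cut just before its first letter \<open>y\<close> above
      \<open>v\<close>.\<close>
    define L where "L = takeWhile (\<lambda>x. f x < f v) as"
    define H where "H = dropWhile (\<lambda>x. f x < f v) as"
    have as: "as = L @ H" by (simp add: L_def H_def)
    have L: "f x < f v" if "x \<in> set L" for x
      using that unfolding L_def by (rule set_takeWhileD[THEN conjunct2])
    with 3 as have "h \<in> set H" by fastforce
    then obtain y ys where H: "H = y # ys" by (cases H) auto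
    then have y: "f v < f y"
      using hd_dropWhile[of "\<lambda>x. f x < f v" as, folded H_def] inj[of y] by (simp add: xs as)
    \<comment> \<open>If no letter below \<open>v\<close> followed \<open>y\<close>, then
      \<open>L\<close> would be nonempty (it would contain \<open>l\<close>) and lie below
      everything after it, a first summand shorter than \<open>as\<close>.\<close>
    have "\<exists>l'\<in>set ys. f l' < f v"
    proof (rule ccontr)
      assume no: "\<not> (\<exists>l'\<in>set ys. f l' < f v)"
      have H': "f v < f x" if "x \<in> set H" for x
      proof -
        have "f x \<noteq> f v" using inj that by (simp add: xs as)
        then show ?thesis using no that y by (auto simp: H)
      qed
      then have "l \<in> set L" using 3 as by fastforce
      then have "split L (H @ bs)"
        using H H' L less as xs ne unfolding split_def by force
      then have "length as \<le> length L" using min by blast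
      then show False using as H by simp
    qed
    then obtain l' where l': "l' \<in> set ys" "f l' < f v" by blast
    \<comment> \<open>Any letter \<open>b\<close> of the second summand plays the 4:
      \<open>y\<close>, \<open>l'\<close>, \<open>b\<close>, \<open>v\<close> have the order
      3142.\<close>
    obtain b where b: "b \<in> set bs" using ne by (cases bs) auto
    have "subseq ([y] @ [l'] @ [b] @ [v]) ((L @ [y]) @ ys @ bs @ [v])"
      using l'(1) b by (intro list_emb_append_mono list_emb_append2) (auto simp: subseq_singleton_left)
    then have "subseq [y, l', b, v] (xs @ [v])" by (simp add: xs as H)
    moreover have "f l' < f v" "f v < f y" "f y < f b"
      using l' y less[of y b] b as H by auto
    ultimately show ?thesis
      using avoids unfolding avoids_def by blast
  qed
qed

text \<open>Induction on the last letter. When the shorter word is a skew sum,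
  \<open>decomposable_snoc\<close> is applied to the negated key, under which it is a direct
  sum.\<close>

lemma decomposable_or_skew_decomposable:
  assumes "avoids f xs" "distinct (map f xs)" "length xs \<ge> 2"
  shows "decomposable f xs \<or> decomposable (\<lambda>x. - f x) xs"
  using assms
proof (induction xs rule: rev_induct)
  case Nil
  then show ?case by simp
next
  case (snoc v xs)
  have neq: "f x \<noteq> f v" if "x \<in> set xs" for x
  proof -
    have "f x \<in> f ` set xs" using that by (rule imageI)
    moreover have "f v \<notin> f ` set xs" using snoc.prems(2) by simp
    ultimately show ?thesis by metis
  qed
  have av: "avoids f xs"
    using snoc.prems(1) by (rule avoids_subseq) (simp add: subseq_rev_drop_many)
  show ?case
  proof (cases "length xs \<ge> 2")
    case True
    with snoc av consider "decomposable f xs" | "decomposable (\<lambda>x. - f x) xs" by auto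
    then show ?thesis
    proof cases
      case 1
      then show ?thesis using decomposable_snoc[of f] snoc.prems neq by blast
    next
      case 2
      then show ?thesis
        using decomposable_snoc[of "\<lambda>x. - f x" xs v] snoc.prems neq by (auto simp: avoids_uminus)
    qed
  next
    case False
    then obtain x where x: "xs = [x]"
      using snoc.prems(3) by (cases xs) (auto simp: Suc_le_eq)
    show ?thesis
      using neq[of x] decomposableI[of "[x]" "[v]" f] decomposableI[of "[x]" "[v]" "\<lambda>x. - f x"]
      unfolding x by fastforce
  qed
qed

text \<open>In a direct sum the first letter lies below the last one, in a skew sum above
  it.\<close>

lemma not_decomposable_and_skew_decomposable:
  assumes "decomposable f xs"
  shows "\<not> decomposable (\<lambda>x. - f x) xs"
proof -
  have *: "g (hd xs) < g (last xs)" if "decomposable g xs" for g :: "'a \<Rightarrow> int"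
    using that by (rule decomposableE) (metis hd_append2 hd_in_set last_appendR last_in_set)
  show ?thesis using *[of f] *[of "\<lambda>x. - f x"] assms by auto
qed

lemma decomposable_rev: "decomposable f (rev xs) \<longleftrightarrow> decomposable (\<lambda>x. - f x) xs"
proof
  assume "decomposable f (rev xs)"
  then obtain as bs where "rev xs = as @ bs" "as \<noteq> []" "bs \<noteq> []"
    "\<And>a b. a \<in> set as \<Longrightarrow> b \<in> set bs \<Longrightarrow> f a < f b"
    by (rule decomposableE) blast
  moreover from this(1) have "xs = rev bs @ rev as"
    by (simp flip: rev_append add: rev_swap)
  ultimately show "decomposable (\<lambda>x. - f x) xs"
    using decomposableI[of "rev bs" "rev as" "\<lambda>x. - f x"] by simp
next
  assume "decomposable (\<lambda>x. - f x) xs"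
  then obtain as bs where "xs = as @ bs" "as \<noteq> []" "bs \<noteq> []"
    "\<And>a b. a \<in> set as \<Longrightarrow> b \<in> set bs \<Longrightarrow> - f a < - f b"
    by (rule decomposableE) blast
  then show "decomposable f (rev xs)"
    using decomposableI[of "rev bs" "rev as" f] by simp
qed

section \<open>Signed words, their blocks, and shifted concatenation\<close>

text \<open>For \<open>S = {-1, 1}\<close> these are the one-line notations of the separable
  elements, for \<open>S = {1}\<close> the ordinary permutations avoiding 3142 and 2413. The
  \<open>sorted_wrt\<close> condition asks for equal signs on each inversion of the absolute values
  and stands for avoiding \<open>[-2, 1]\<close> and \<open>[2, -1]\<close>.\<close>

definition separable_words :: "int set \<Rightarrow> nat \<Rightarrow> int list set" where
  "separable_words S n = {xs. distinct (map abs xs) \<and> abs ` set xs = {1..int n} \<and> sgn ` set xs \<subseteq> S \<and>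
     sorted_wrt (\<lambda>a b. \<bar>b\<bar> < \<bar>a\<bar> \<longrightarrow> sgn a = sgn b) xs \<and> avoids abs xs}"

text \<open>The empty word belongs to \<open>blocks S 0\<close>, so sums over the length of a first
  block start at 1.\<close>

definition blocks :: "int set \<Rightarrow> nat \<Rightarrow> int list set" where
  "blocks S n = {xs \<in> separable_words S n. \<not> decomposable abs xs}"

text \<open>Renumbers the second summand of a direct sum: absolute values move above those of a
  first summand of length \<open>k\<close>, signs stay.\<close>

definition shift :: "nat \<Rightarrow> int \<Rightarrow> int" where
  "shift k x = x + sgn x * int k"

lemma abs_shift: "x \<noteq> 0 \<Longrightarrow> \<bar>shift k x\<bar> = \<bar>x\<bar> + int k"
  by (auto simp: shift_def sgn_if)

lemma sgn_shift: "sgn (shift k x) = sgn x"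
  by (auto simp: shift_def sgn_if)

lemma inj_shift: "inj (shift k)"
  by (rule injI) (auto simp: shift_def sgn_if split: if_splits)

lemma separable_words_bounds:
  assumes "xs \<in> separable_words S n" "x \<in> set xs"
  shows "1 \<le> \<bar>x\<bar>" "\<bar>x\<bar> \<le> int n" "x \<noteq> 0"
proof -
  have "\<bar>x\<bar> \<in> {1..int n}"
    using assms unfolding separable_words_def by blast
  then show "1 \<le> \<bar>x\<bar>" "\<bar>x\<bar> \<le> int n" "x \<noteq> 0" by auto
qed

lemma length_eq_if_abs_image:
  assumes "distinct (map abs xs)" "abs ` set xs = {1..int n}"
  shows "length xs = n"
  using distinct_card[OF assms(1)] assms(2) by simp

lemma length_separable_words: "xs \<in> separable_words S n \<Longrightarrow> length xs = n"
  unfolding separable_words_def by (auto intro: length_eq_if_abs_image)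

lemma finite_separable_words: "finite (separable_words S n)"
proof (rule finite_subset)
  show "separable_words S n \<subseteq> {xs. set xs \<subseteq> {- int n..int n} \<and> length xs = n}"
    using separable_words_bounds(2) length_separable_words by fastforce
  show "finite {xs. set xs \<subseteq> {- int n..int n} \<and> length xs = n}"
    by (rule finite_lists_length_eq) simp
qed

text \<open>Absolute values increase from \<open>as\<close> to the shifted \<open>bs\<close>, so no
  inversion and no excluded order crosses the boundary, and each defining condition splits into one
  for \<open>as\<close> and one for \<open>bs\<close>.\<close>

lemma append_shift_mem_separable_words:
  assumes as: "abs ` set as = {1..int k}" and bs: "0 \<notin> set bs"
  shows "as @ map (shift k) bs \<in> separable_words S (k + m) \<longleftrightarrow>
    as \<in> separable_words S k \<and> bs \<in> separable_words S m"
proof -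
  have as_le: "\<bar>a\<bar> \<le> int k" if "a \<in> set as" for a
    using as that by (metis atLeastAtMost_iff image_eqI)
  have bs_abs: "\<bar>shift k b\<bar> = \<bar>b\<bar> + int k" "\<bar>b\<bar> > 0" if "b \<in> set bs" for b
    using bs that by (auto intro!: abs_shift)
  have less: "\<bar>a\<bar> < \<bar>b\<bar>" if "a \<in> set as" "b \<in> set (map (shift k) bs)" for a b
    using that as_le[of a] bs_abs by force
  have map_abs: "map abs (map (shift k) bs) = map (\<lambda>x. x + int k) (map abs bs)"
    using bs_abs by simp
  have img: "abs ` set (map (shift k) bs) = (\<lambda>x. x + int k) ` abs ` set bs"
    using arg_cong[OF map_abs, of set] by (simp only: set_map)
  have dist: "distinct (map abs (as @ map (shift k) bs)) \<longleftrightarrow>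
      distinct (map abs as) \<and> distinct (map abs bs)"
  proof -
    have "distinct (map abs (map (shift k) bs)) \<longleftrightarrow> distinct (map abs bs)"
      unfolding map_abs by (subst distinct_map) (auto simp: inj_on_def)
    moreover have "abs ` set as \<inter> abs ` set (map (shift k) bs) = {}"
      using less by fastforce
    ultimately show ?thesis
      unfolding map_append distinct_append set_map[of abs] by blast
  qed
  have range: "abs ` set (as @ map (shift k) bs) = {1..int (k + m)} \<longleftrightarrow> abs ` set bs = {1..int m}"
  proof -
    have "abs ` set (as @ map (shift k) bs) = {1..int k} \<union> (\<lambda>x. x + int k) ` abs ` set bs"
      using as img by (simp add: image_Un)
    moreover have "{1..int (k + m)} = {1..int k} \<union> (\<lambda>x. x + int k) ` {1..int m}"
      by auto
    moreover have "{1..int k} \<inter> (\<lambda>x. x + int k) ` abs ` set bs = {}"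
      using bs_abs by fastforce
    moreover have "{1..int k} \<inter> (\<lambda>x. x + int k) ` {1..int m} = {}"
      by auto
    moreover have "A \<union> X = A \<union> Y \<longleftrightarrow> X = Y" if "A \<inter> X = {}" "A \<inter> Y = {}" for A X Y :: "int set"
      using that by blast
    ultimately have "abs ` set (as @ map (shift k) bs) = {1..int (k + m)} \<longleftrightarrow>
        (\<lambda>x. x + int k) ` abs ` set bs = (\<lambda>x. x + int k) ` {1..int m}"
      by metis
    also have "\<dots> \<longleftrightarrow> abs ` set bs = {1..int m}"
      by (rule inj_image_eq_iff) (simp add: inj_def)
    finally show ?thesis .
  qed
  have sorted: "sorted_wrt (\<lambda>a b. \<bar>b\<bar> < \<bar>a\<bar> \<longrightarrow> sgn a = sgn b) (as @ map (shift k) bs) \<longleftrightarrow>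
    sorted_wrt (\<lambda>a b. \<bar>b\<bar> < \<bar>a\<bar> \<longrightarrow> sgn a = sgn b) as \<and>
    sorted_wrt (\<lambda>a b. \<bar>b\<bar> < \<bar>a\<bar> \<longrightarrow> sgn a = sgn b) bs" (is "sorted_wrt ?P _ \<longleftrightarrow> _")
  proof -
    have "sorted_wrt ?P (map (shift k) bs) \<longleftrightarrow> sorted_wrt ?P bs"
      unfolding sorted_wrt_map
      by (intro iffI; erule sorted_wrt_mono_rel[rotated]) (auto simp: bs_abs sgn_shift)
    moreover have "\<forall>a\<in>set as. \<forall>b\<in>set (map (shift k) bs). ?P a b"
      using less by (meson order.asym)
    ultimately show ?thesis unfolding sorted_wrt_append by blast
  qed
  have "avoids abs (map (shift k) bs) \<longleftrightarrow> avoids abs bs"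
    unfolding avoids_map by (rule avoids_cong_order) (simp add: bs_abs)
  then have avoids: "avoids abs (as @ map (shift k) bs) \<longleftrightarrow> avoids abs as \<and> avoids abs bs"
    using avoids_append[of as "map (shift k) bs" abs] less by blast
  have sgn: "sgn ` set (as @ map (shift k) bs) = sgn ` set as \<union> sgn ` set bs"
    by (auto simp: sgn_shift image_Un image_image)
  show ?thesis
    unfolding separable_words_def mem_Collect_eq dist range sorted avoids sgn
    using as by auto
qed

section \<open>Unique splitting into a first block and a remainder\<close>

text \<open>One of the two first blocks is a prefix of the other. A nonempty excess would consist of
  shifted letters, all larger in absolute value than the shorter block, and would decompose the
  longer one.\<close>

lemma first_block_prefix_eq:
  assumes "as @ map (shift (length as)) bs = as' @ map (shift (length as')) bs'"
    and "as \<in> blocks S (length as)" "as' \<in> blocks S (length as')"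
    and "bs \<in> separable_words S m" "bs' \<in> separable_words S m'" "as \<noteq> []" "as' \<noteq> []"
  shows "as = as'"
proof -
  have *: "us = []"
    if "as = as' @ us" "us @ ws = map (shift (length as')) bs'" "as' \<noteq> []"
      "as \<in> blocks S (length as)" "as' \<in> blocks S (length as')" "bs' \<in> separable_words S m'"
    for as as' us ws bs' :: "int list" and m'
  proof (rule ccontr)
    assume "us \<noteq> []"
    have "decomposable abs (as' @ us)"
    proof (rule decomposableI)
      fix a u assume "a \<in> set as'" "u \<in> set us"
      then have "\<bar>a\<bar> \<le> int (length as')"
        using that(5) separable_words_bounds(2) unfolding blocks_def by blast
      moreover have "u \<in> set (map (shift (length as')) bs')"
        using \<open>u \<in> set us\<close> that(2) by (metis UnCI set_append)
      then obtain b where "b \<in> set bs'" "u = shift (length as') b" by auto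
      then have "\<bar>u\<bar> > int (length as')"
        using separable_words_bounds[OF that(6)] by (simp add: abs_shift)
      ultimately show "\<bar>a\<bar> < \<bar>u\<bar>" by simp
    qed (use \<open>us \<noteq> []\<close> that(3) in auto)
    then show False using that(1,4) unfolding blocks_def by blast
  qed
  from assms(1) consider
      us where "as = as' @ us" "us @ map (shift (length as)) bs = map (shift (length as')) bs'"
    | us where "as' = as @ us" "us @ map (shift (length as')) bs' = map (shift (length as)) bs"
    unfolding append_eq_append_conv2 by metis
  then show ?thesis
    by cases (use * assms in \<open>metis append_Nil2\<close>)+
qed

text \<open>The first block is the shortest nonempty prefix whose absolute values lie below those of
  the rest; a decomposition of it would yield a shorter such prefix.\<close>

lemma first_block_exists:
  assumes xs: "xs \<in> separable_words S n" and "n \<ge> 1"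
  obtains k as bs where "1 \<le> k" "k \<le> n" "as \<in> blocks S k" "bs \<in> separable_words S (n - k)"
    "xs = as @ map (shift k) bs"
proof -
  \<comment> \<open>The second part may be empty here, so an indecomposable word is its own first
    block.\<close>
  define split where "split = (\<lambda>as bs. xs = as @ bs \<and> as \<noteq> [] \<and> (\<forall>a\<in>set as. \<forall>b\<in>set bs. \<bar>a\<bar> < \<bar>b\<bar>))"
  have "split xs []"
    using length_separable_words[OF xs] \<open>n \<ge> 1\<close> unfolding split_def by auto
  then obtain as where "\<exists>bs. split as bs"
    and min: "\<And>as'. \<exists>bs. split as' bs \<Longrightarrow> length as \<le> length as'"
    by (metis (no_types, lifting) ex_has_least_nat[of "\<lambda>as. \<exists>bs. split as bs" _ length])
  then obtain cs where s: "split as cs" by blast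
  then have xs_eq: "xs = as @ cs" and ne: "as \<noteq> []"
    and less: "\<And>a b. a \<in> set as \<Longrightarrow> b \<in> set cs \<Longrightarrow> \<bar>a\<bar> < \<bar>b\<bar>"
    unfolding split_def by auto
  define k where "k = length as"
  define bs where "bs = map (\<lambda>x. x - sgn x * int k) cs"
  have k: "1 \<le> k" "k \<le> n"
    using ne length_separable_words[OF xs] unfolding k_def xs_eq by (auto simp: Suc_le_eq)
  have dist: "distinct (map abs as)" and img: "abs ` set as \<union> abs ` set cs = {1..int n}"
    using xs unfolding separable_words_def xs_eq by (auto simp: image_Un)
  have card_as: "card (abs ` set as) = k"
    using distinct_card[OF dist] by (simp add: k_def)
  \<comment> \<open>The absolute values in \<open>as\<close> form a downward closed set of
    \<open>k\<close> elements of \<open>{1..int n}\<close>, which must be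
    \<open>{1..int k}\<close>.\<close>
  have down: "y \<in> abs ` set as" if "x \<in> abs ` set as" "1 \<le> y" "y \<le> x" for x y
  proof -
    have "x \<le> int n" using that img by (metis UnCI atLeastAtMost_iff)
    then have "y \<in> abs ` set as \<union> abs ` set cs" using that img by auto
    then show ?thesis using less that by fastforce
  qed
  have as_le: "x \<le> int k" if "x \<in> abs ` set as" for x
  proof -
    have "{1..x} \<subseteq> abs ` set as" using down[OF that] by auto
    then have "card {1..x} \<le> k" using card_mono[of "abs ` set as" "{1..x}"] card_as by simp
    then show ?thesis by (simp add: nat_le_iff)
  qed
  have img_as: "abs ` set as = {1..int k}"
  proof (rule card_subset_eq)
    show "abs ` set as \<subseteq> {1..int k}" using as_le img by (metis Un_iff atLeastAtMost_iff subsetI)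
  qed (simp_all add: card_as)
  have cs_gt: "\<bar>c\<bar> > int k" if "c \<in> set cs" for c
  proof -
    have "int k \<in> abs ` set as" using k img_as by simp
    then show ?thesis using less[OF _ that] by force
  qed
  \<comment> \<open>Absolute values in \<open>cs\<close> exceed \<open>k\<close>, so lowering them
    by \<open>k\<close> never reaches 0 or changes a sign, and \<open>shift k\<close> undoes
    it.\<close>
  have cs: "cs = map (shift k) bs"
    unfolding bs_def map_map using cs_gt
    by (intro map_idI[symmetric]) (fastforce simp: shift_def sgn_if)
  have "0 \<notin> set bs"
    using cs_gt unfolding bs_def by (fastforce simp: sgn_if split: if_splits)
  moreover have "as @ map (shift k) bs \<in> separable_words S (k + (n - k))"
    using xs k cs xs_eq by simp
  ultimately have mem: "as \<in> separable_words S k" "bs \<in> separable_words S (n - k)"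
    using append_shift_mem_separable_words[OF img_as] by blast+
  have "\<not> decomposable abs as"
  proof
    assume "decomposable abs as"
    then obtain us vs where uv: "as = us @ vs" "us \<noteq> []" "vs \<noteq> []"
      "\<And>u v. u \<in> set us \<Longrightarrow> v \<in> set vs \<Longrightarrow> \<bar>u\<bar> < \<bar>v\<bar>"
      by (rule decomposableE) blast
    then have "split us (vs @ cs)"
      using less unfolding split_def xs_eq by auto
    then have "length as \<le> length us" using min by blast
    then show False using uv by simp
  qed
  then show thesis
    using that[OF k _ mem(2)] mem(1) xs_eq cs unfolding blocks_def by auto
qed

text \<open>Counts by the length \<open>k\<close> of the first block; existence and uniqueness of
  the splitting make concatenation with a shift a bijection.\<close>

lemma card_separable_words:
  assumes "n \<ge> 1"
  shows "card (separable_words S n) = (\<Sum>k=1..n. card (blocks S k) * card (separable_words S (n - k)))"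
proof -
  let ?A = "SIGMA k:{1..n}. blocks S k \<times> separable_words S (n - k)"
  let ?f = "\<lambda>(k, as, bs). as @ map (shift k) bs"
  have inj: "inj_on ?f ?A"
  proof (rule inj_onI)
    fix p q assume "p \<in> ?A" "q \<in> ?A" "?f p = ?f q"
    then obtain k as bs k' as' bs' where pq: "p = (k, as, bs)" "q = (k', as', bs')"
      and *: "k \<in> {1..n}" "as \<in> blocks S k" "bs \<in> separable_words S (n - k)"
      "k' \<in> {1..n}" "as' \<in> blocks S k'" "bs' \<in> separable_words S (n - k')"
      and eq: "as @ map (shift k) bs = as' @ map (shift k') bs'"
      by auto
    have len: "k = length as" "k' = length as'"
      using * length_separable_words unfolding blocks_def by blast+
    moreover have "as \<noteq> []" "as' \<noteq> []" using len * by auto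
    ultimately have "as = as'"
      using first_block_prefix_eq[of as bs as' bs' S "n - k" "n - k'"] * eq by simp
    with eq len inj_shift show "p = q"
      by (auto simp: pq dest: map_injective)
  qed
  have img: "?f ` ?A = separable_words S n"
  proof (intro subset_antisym subsetI)
    fix xs assume "xs \<in> ?f ` ?A"
    then obtain k as bs where *: "k \<in> {1..n}" "as \<in> blocks S k" "bs \<in> separable_words S (n - k)"
      and xs: "xs = as @ map (shift k) bs" by auto
    have "abs ` set as = {1..int k}" "as \<in> separable_words S k"
      using *(2) unfolding blocks_def separable_words_def by auto
    moreover have "0 \<notin> set bs" using separable_words_bounds(3)[OF *(3)] by blast
    ultimately have "xs \<in> separable_words S (k + (n - k))"
      using append_shift_mem_separable_words *(3) xs by blast
    then show "xs \<in> separable_words S n" using *(1) by simp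
  next
    fix xs assume "xs \<in> separable_words S n"
    then show "xs \<in> ?f ` ?A"
      using assms by (rule first_block_exists) force
  qed
  have fin: "finite (blocks S k)" for k
    using finite_separable_words unfolding blocks_def by auto
  have "card (separable_words S n) = card ?A"
    using card_image[OF inj] img by simp
  also have "\<dots> = (\<Sum>k=1..n. card (blocks S k) * card (separable_words S (n - k)))"
    using fin finite_separable_words by (simp add: card_SigmaI card_cartesian_product)
  finally show ?thesis .
qed

section \<open>Signs of blocks\<close>

text \<open>Cut the word before its first change of sign. Inversions join only letters of equal
  sign, and this forces all letters before the cut to be smaller in absolute value than those after
  it, contrary to indecomposability.\<close>

lemma block_constant_sign:
  assumes "xs \<in> blocks {-1, 1} n"
  obtains s where "s \<in> {-1, 1}" "sgn ` set xs \<subseteq> {s}"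
proof (cases xs)
  case Nil
  then show thesis using that[of 1] by simp
next
  case (Cons x xs')
  define P where "P = takeWhile (\<lambda>y. sgn y = sgn x) xs"
  define R where "R = dropWhile (\<lambda>y. sgn y = sgn x) xs"
  have xs: "xs = P @ R" by (simp add: P_def R_def)
  have P: "sgn y = sgn x" if "y \<in> set P" for y
    using that unfolding P_def by (rule set_takeWhileD[THEN conjunct2])
  have mem: "xs \<in> separable_words {-1, 1} n" "\<not> decomposable abs xs"
    using assms unfolding blocks_def by auto
  then have sgn: "sgn y \<in> {-1, 1}" if "y \<in> set xs" for y
    using that unfolding separable_words_def by blast
  have "R = []"
  proof (rule ccontr)
    assume "R \<noteq> []"
    then obtain y ys where R: "R = y # ys" by (cases R) auto
    then have y: "sgn y \<noteq> sgn x"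
      using hd_dropWhile[of "\<lambda>y. sgn y = sgn x" xs, folded R_def] by simp
    have sw: "sorted_wrt (\<lambda>a b. \<bar>b\<bar> < \<bar>a\<bar> \<longrightarrow> sgn a = sgn b) (P @ y # ys)"
      and dist: "distinct (map abs (P @ y # ys))"
      using mem unfolding separable_words_def xs R by auto
    have neq: "\<bar>p\<bar> \<noteq> \<bar>r\<bar>" if "p \<in> set P" "r \<in> set (y # ys)" for p r
      using dist that by (auto simp: image_iff)
    have "decomposable abs (P @ y # ys)"
    proof (rule decomposableI)
      show "P \<noteq> []" by (simp add: P_def Cons)
      fix p r assume p: "p \<in> set P" and r: "r \<in> set (y # ys)"
      have py: "\<bar>p\<bar> < \<bar>y\<bar>"
        using sw p y P[OF p] neq[OF p, of y] by (force simp: sorted_wrt_append)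
      show "\<bar>p\<bar> < \<bar>r\<bar>"
      proof (rule ccontr)
        assume "\<not> \<bar>p\<bar> < \<bar>r\<bar>"
        \<comment> \<open>Since \<open>p\<close> is below \<open>y\<close> in absolute value,
          \<open>r\<close> is inverted with both \<open>p\<close> and \<open>y\<close>, whose signs
          differ.\<close>
        then have "\<bar>r\<bar> < \<bar>p\<bar>" using neq[OF p r] by simp
        moreover have "r \<in> set ys" using r py \<open>\<bar>r\<bar> < \<bar>p\<bar>\<close> by auto
        ultimately have "sgn p = sgn r" "sgn y = sgn r"
          using sw p py by (auto simp: sorted_wrt_append)
        then show False using y P[OF p] by simp
      qed
    qed simp
    then show False using mem xs R by simp
  qed
  then have "sgn ` set xs \<subseteq> {sgn x}" using P xs by auto
  then show thesis using that sgn[of x] Cons by auto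
qed

lemma map_uminus_mem_blocks:
  assumes "xs \<in> blocks S n"
  shows "map uminus xs \<in> blocks (uminus ` S) n"
proof -
  have dec: "decomposable abs xs" if "decomposable abs (map uminus xs)"
  proof -
    from that obtain as bs where *: "map uminus xs = as @ bs" "as \<noteq> []" "bs \<noteq> []"
      "\<And>a b. a \<in> set as \<Longrightarrow> b \<in> set bs \<Longrightarrow> \<bar>a\<bar> < \<bar>b\<bar>"
      by (rule decomposableE) blast
    have "xs = map uminus (map uminus xs)" by (simp add: comp_def)
    then have "xs = map uminus as @ map uminus bs" using *(1) by simp
    moreover have "decomposable abs (map uminus as @ map uminus bs)"
      by (rule decomposableI) (use *(2-4) in auto)
    ultimately show ?thesis by simp
  qed
  have "sgn ` set (map uminus xs) = uminus ` sgn ` set xs"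
    by (simp add: image_image sgn_minus)
  then show ?thesis
    using assms dec unfolding blocks_def separable_words_def
    by (auto simp: avoids_map comp_def image_image sorted_wrt_map sgn_minus)
qed

text \<open>A nonempty block is all positive or all negative, and negating every letter exchanges
  the two classes. For length 0 they would share the empty word.\<close>

lemma card_blocks_signed:
  assumes "n \<ge> 1"
  shows "card (blocks {-1, 1} n) = 2 * card (blocks {1} n)"
proof -
  have sub: "blocks {s} n \<subseteq> blocks {-1, 1} n" if "s \<in> {-1, 1}" for s
    using that unfolding blocks_def separable_words_def by auto
  have sgn: "xs \<in> blocks {s} n" if "xs \<in> blocks {-1, 1} n" "sgn ` set xs \<subseteq> {s}" for xs s
    using that unfolding blocks_def separable_words_def by auto
  have union: "blocks {-1, 1} n = blocks {1} n \<union> blocks {-1} n"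
  proof
    show "blocks {-1, 1} n \<subseteq> blocks {1} n \<union> blocks {-1} n"
    proof
      fix xs assume xs: "xs \<in> blocks {-1, 1} n"
      then obtain s where s: "s \<in> {-1, 1}" "sgn ` set xs \<subseteq> {s}"
        by (rule block_constant_sign)
      from sgn[OF xs s(2)] s(1) show "xs \<in> blocks {1} n \<union> blocks {-1} n" by auto
    qed
  qed (use sub in simp)
  have fin: "finite (blocks S n)" for S
    using finite_separable_words unfolding blocks_def by auto
  have disj: "blocks {1} n \<inter> blocks {-1} n = {}"
  proof (rule ccontr)
    assume "\<not> ?thesis"
    then obtain xs where xs: "xs \<in> separable_words {1} n" "xs \<in> separable_words {-1} n"
      unfolding blocks_def by auto
    then have "xs = []" unfolding separable_words_def by (cases xs) auto
    then show False using length_separable_words[OF xs(1)] assms by simp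
  qed
  have uminus_inv: "map uminus (map uminus xs) = xs" for xs :: "int list"
    by (simp add: comp_def)
  have "bij_betw (map uminus) (blocks {1} n) (blocks {-1} n)"
    by (rule bij_betwI[where g = "map uminus"])
       (use map_uminus_mem_blocks[of _ "{1}" n] map_uminus_mem_blocks[of _ "{-1}" n] uminus_inv
         in auto)
  then have "card (blocks {-1} n) = card (blocks {1} n)"
    by (simp add: bij_betw_same_card)
  then show ?thesis
    unfolding union using card_Un_disjoint[OF fin fin disj] by simp
qed

section \<open>Reversal of positive words\<close>

text \<open>Of a positive word of length at least 2 and its reversal, exactly one is a block.\<close>

lemma card_separable_words_positive:
  assumes "n \<ge> 2"
  shows "card (separable_words {1} n) = 2 * card (blocks {1} n)"
proof -
  let ?W = "separable_words {1} n"
  have rev_mem: "rev xs \<in> ?W" if xs: "xs \<in> ?W" for xs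
  proof -
    \<comment> \<open>With all letters positive the sign condition is vacuous, so it survives
      reversal.\<close>
    have "sgn x = 1" if "x \<in> set xs" for x
      using xs that unfolding separable_words_def by auto
    then have "sorted_wrt (\<lambda>a b. \<bar>b\<bar> < \<bar>a\<bar> \<longrightarrow> sgn a = sgn b) (rev xs)"
      by (intro sorted_wrt_mono_rel[OF _ sorted_wrt_true]) simp
    then show ?thesis
      using xs unfolding separable_words_def by (simp add: avoids_rev rev_map flip: rev_map)
  qed
  have iff: "decomposable abs (rev xs) \<longleftrightarrow> \<not> decomposable abs xs" if "xs \<in> ?W" for xs
  proof -
    have "avoids abs xs" "distinct (map abs xs)"
      using that unfolding separable_words_def by auto
    moreover have "length xs \<ge> 2" using length_separable_words[OF that] assms by simp
    ultimately show ?thesis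
      using decomposable_or_skew_decomposable not_decomposable_and_skew_decomposable decomposable_rev
      by blast
  qed
  have "bij_betw rev (blocks {1} n) (?W - blocks {1} n)"
    by (rule bij_betwI[where g = rev]) (use rev_mem iff in \<open>auto simp: blocks_def\<close>)
  then have "card (?W - blocks {1} n) = card (blocks {1} n)"
    by (simp add: bij_betw_same_card)
  moreover have "card ?W = card (blocks {1} n) + card (?W - blocks {1} n)"
    using finite_separable_words card_Diff_subset[of "blocks {1} n" ?W]
      card_mono[of ?W "blocks {1} n"]
    by (auto simp: blocks_def intro: finite_subset)
  ultimately show ?thesis by simp
qed

section \<open>From the convolutions to the large Schroeder numbers\<close>

lemma separable_words_0: "separable_words S 0 = {[]}"
  unfolding separable_words_def by (auto simp: avoids_def)

text \<open>The starting value, outside the range of the doubling relation.\<close>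

lemma card_separable_words_1: "card (separable_words {1} 1) = 1"
proof -
  have "separable_words {1} 1 = {[1]}"
  proof (intro subset_antisym subsetI)
    fix xs assume xs: "xs \<in> separable_words {1} 1"
    then obtain x where "xs = [x]"
      using length_separable_words[OF xs] by (auto simp: length_Suc_conv)
    then show "xs \<in> {[1]}" using xs unfolding separable_words_def by (auto simp: sgn_if split: if_splits)
  qed (auto simp: separable_words_def avoids_def)
  then show ?thesis by simp
qed

lemma card_separable_words_signed:
  "card (separable_words {-1, 1} n) = card (separable_words {1} (Suc n))"
proof (induction n rule: less_induct)
  case (less n)
  let ?A = "\<lambda>n. card (separable_words {1} n)" and ?K = "\<lambda>n. card (separable_words {-1, 1} n)"
    and ?I = "\<lambda>n. card (blocks {1} n)"
  show ?case
  proof (cases "n = 0")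
    case True
    then show ?thesis using card_separable_words_1 by (simp add: separable_words_0)
  next
    case False
    have "?A (Suc n) = (\<Sum>k=1..Suc n. ?I k * ?A (Suc n - k))"
      by (rule card_separable_words) simp
    also have "\<dots> = (\<Sum>k=1..n. ?I k * ?A (Suc (n - k))) + ?I (Suc n)"
      by (simp add: separable_words_0 Suc_diff_le)
    \<comment> \<open>The last term of the sum, with empty remainder, is half of the left side.
      Moving it over doubles the remaining terms.\<close>
    also have "?I (Suc n) = ?A (Suc n) - ?I (Suc n)"
      using card_separable_words_positive[of "Suc n"] False by simp
    finally have "?A (Suc n) = 2 * (\<Sum>k=1..n. ?I k * ?A (Suc (n - k)))"
      using card_separable_words_positive[of "Suc n"] False by simp
    also have "\<dots> = (\<Sum>k=1..n. 2 * ?I k * ?K (n - k))"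
      unfolding sum_distrib_left using less by (intro sum.cong) auto
    also have "\<dots> = (\<Sum>k=1..n. card (blocks {-1, 1} k) * ?K (n - k))"
      by (intro sum.cong) (simp_all add: card_blocks_signed)
    also have "\<dots> = ?K n"
      using card_separable_words[of n] False by simp
    finally show ?thesis by simp
  qed
qed

lemma card_separable_words_eq_large_schroeder:
  "card (separable_words {-1, 1} n) = large_schroeder n"
proof (induction n rule: less_induct)
  case (less n)
  let ?K = "\<lambda>n. card (separable_words {-1, 1} n)"
  show ?case
  proof (cases n)
    case 0
    then show ?thesis by (simp add: separable_words_0)
  next
    case (Suc m)
    \<comment> \<open>The two one-letter blocks exceed \<open>?K 0\<close> by one. This correction
      at \<open>k = 0\<close> becomes the separate summand \<open>large_schroeder m\<close> of the
      recurrence.\<close>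
    have block: "card (blocks {-1, 1} (Suc k)) = ?K k + (if k = 0 then 1 else 0)" for k
    proof (cases "k = 0")
      case True
      have "card (separable_words {1} 1) = card (blocks {1} 1)"
        using card_separable_words[of 1 "{1}"] by (simp add: separable_words_0)
      then show ?thesis
        using card_separable_words_1 True by (simp add: card_blocks_signed separable_words_0)
    next
      case False
      then show ?thesis
        using card_separable_words_positive[of "Suc k"]
        by (simp add: card_blocks_signed card_separable_words_signed)
    qed
    have "?K n = (\<Sum>k=1..Suc m. card (blocks {-1, 1} k) * ?K (Suc m - k))"
      unfolding Suc by (rule card_separable_words) simp
    also have "\<dots> = (\<Sum>k=0..m. card (blocks {-1, 1} (Suc k)) * ?K (m - k))"
      using sum.shift_bounds_cl_Suc_ivl[of "\<lambda>k. card (blocks {-1, 1} k) * ?K (Suc m - k)" 0 m] by simp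
    also have "\<dots> = (\<Sum>k=0..m. ?K k * ?K (m - k) + (if k = 0 then ?K m else 0))"
      by (intro sum.cong refl) (simp add: block algebra_simps)
    also have "\<dots> = (\<Sum>k=0..m. ?K k * ?K (m - k)) + ?K m"
      by (simp add: sum.distrib)
    also have "\<dots> = (\<Sum>k=0..m. large_schroeder k * large_schroeder (m - k)) + large_schroeder m"
      using less Suc by simp
    finally show ?thesis using Suc by simp
  qed
qed

section \<open>Signed permutations and their one-line notation\<close>

lemma signed_permsD:
  assumes "w \<in> signed_perms n"
  shows "w permutes {i. i \<noteq> 0 \<and> \<bar>i\<bar> \<le> int n}" "w (- i) = - w i"
  using assms unfolding signed_perms_def by auto

text \<open>Oddness determines \<open>w\<close> from its values at positive arguments, and
  conversely extends a word of the given kind to a signed permutation.\<close>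

lemma bij_betw_one_line:
  "bij_betw (one_line n) (signed_perms n) {xs. distinct (map abs xs) \<and> abs ` set xs = {1..int n}}"
  (is "bij_betw _ _ ?W")
proof (rule bij_betwI')
  let ?D = "{i. i \<noteq> 0 \<and> \<bar>i\<bar> \<le> int n}"
  fix w v assume w: "w \<in> signed_perms n" and v: "v \<in> signed_perms n"
  show "one_line n w = one_line n v \<longleftrightarrow> w = v"
  proof
    assume "one_line n w = one_line n v"
    then have pos: "w i = v i" if "1 \<le> i" "i \<le> int n" for i
      using that by (auto simp: one_line_def)
    show "w = v"
    proof
      fix i
      consider "i \<notin> ?D" | "1 \<le> i" "i \<le> int n" | "1 \<le> - i" "- i \<le> int n"
        by fastforce
      then show "w i = v i"
      proof cases
        case 1
        then show ?thesis
          using permutes_not_in[OF signed_permsD(1)[OF w]] permutes_not_in[OF signed_permsD(1)[OF v]]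
          by simp
      next
        case 3
        then show ?thesis using pos[of "- i"] signed_permsD(2)[OF w] signed_permsD(2)[OF v] by simp
      qed (rule pos)
    qed
  qed simp
next
  let ?D = "{i. i \<noteq> 0 \<and> \<bar>i\<bar> \<le> int n}"
  fix w assume w: "w \<in> signed_perms n"
  note perm = signed_permsD(1)[OF w] and odd = signed_permsD(2)[OF w]
  have "inj_on (\<lambda>i. \<bar>w i\<bar>) {1..int n}"
  proof (rule inj_onI)
    fix i j assume ij: "i \<in> {1..int n}" "j \<in> {1..int n}" "\<bar>w i\<bar> = \<bar>w j\<bar>"
    then have "w i = w j \<or> w i = w (- j)" by (auto simp: odd abs_eq_iff)
    then have "i = j \<or> i = - j" using permutes_inj[OF perm] by (auto dest: injD)
    then show "i = j" using ij by auto
  qed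
  then have "distinct (map abs (one_line n w))"
    by (simp add: one_line_def distinct_map comp_def)
  moreover have "abs ` set (one_line n w) = {1..int n}"
  proof
    have "w i \<in> ?D" if "i \<in> {1..int n}" for i
      using permutes_in_image[OF perm, of i] that by simp
    then show "abs ` set (one_line n w) \<subseteq> {1..int n}"
      by (force simp: one_line_def)
    show "{1..int n} \<subseteq> abs ` set (one_line n w)"
    proof
      fix y assume y: "y \<in> {1..int n}"
      then have "y \<in> w ` ?D" using permutes_image[OF perm] by simp
      then obtain i where i: "i \<in> ?D" "y = w i" by blast
      \<comment> \<open>The preimage \<open>i\<close> may be negative; oddness gives the same
        absolute value at the positive argument.\<close>
      then have "\<bar>w \<bar>i\<bar>\<bar> = y" using y odd[of i] by (auto simp: abs_if)
      moreover have "\<bar>i\<bar> \<in> {1..int n}" using i by auto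
      ultimately show "y \<in> abs ` set (one_line n w)" by (force simp: one_line_def)
    qed
  qed
  ultimately show "one_line n w \<in> ?W" by blast
next
  let ?D = "{i. i \<noteq> 0 \<and> \<bar>i\<bar> \<le> int n}"
  fix xs assume "xs \<in> ?W"
  then have dist: "distinct (map abs xs)" and img: "abs ` set xs = {1..int n}" by auto
  have len: "length xs = n" using length_eq_if_abs_image[OF dist img] .
  \<comment> \<open>The factor \<open>sgn i\<close> makes \<open>w\<close> odd, and
    \<open>\<bar>i\<bar> - 1\<close> accounts for list positions starting at 0.\<close>
  define w where "w i = (if i \<in> ?D then sgn i * xs ! nat (\<bar>i\<bar> - 1) else i)" for i
  have idx: "nat (\<bar>i\<bar> - 1) < length xs" if "i \<in> ?D" for i
    using that len by auto
  have abs_w: "\<bar>w i\<bar> = \<bar>xs ! nat (\<bar>i\<bar> - 1)\<bar>" if "i \<in> ?D" for i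
    using that by (simp add: w_def abs_mult)
  have range: "\<bar>xs ! j\<bar> \<in> {1..int n}" if "j < length xs" for j
    using img that by (metis image_eqI nth_mem)
  have odd: "w (- i) = - w i" for i
    by (simp add: w_def sgn_minus)
  have "inj_on w ?D"
  proof (rule inj_onI)
    fix i j assume ij: "i \<in> ?D" "j \<in> ?D" and eq: "w i = w j"
    have "map abs xs ! nat (\<bar>i\<bar> - 1) = map abs xs ! nat (\<bar>j\<bar> - 1)"
      using abs_w[OF ij(1)] abs_w[OF ij(2)] idx[OF ij(1)] idx[OF ij(2)] eq by simp
    then have "nat (\<bar>i\<bar> - 1) = nat (\<bar>j\<bar> - 1)"
      using idx[OF ij(1)] idx[OF ij(2)] nth_eq_iff_index_eq[OF dist] by simp
    then have *: "\<bar>i\<bar> = \<bar>j\<bar>" using ij by auto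
    then have "sgn i = sgn j"
      using eq ij range[OF idx[OF ij(1)]] by (auto simp: w_def)
    then show "i = j" using * by (metis abs_mult_sgn mult.commute)
  qed
  moreover have "w i \<in> ?D" if "i \<in> ?D" for i
    using range[OF idx[OF that]] abs_w[OF that] by auto
  moreover have "finite ?D"
    by (rule finite_subset[of _ "{- int n..int n}"]) auto
  ultimately have "w ` ?D = ?D" by (meson endo_inj_surj image_subsetI)
  then have "w permutes ?D"
    using \<open>inj_on w ?D\<close> by (intro bij_imp_permutes) (auto simp: bij_betw_def w_def)
  then have "w \<in> signed_perms n" using odd by (simp add: signed_perms_def)
  moreover have "one_line n w = xs"
  proof (rule nth_equalityI)
    fix j assume "j < length (one_line n w)"
    then show "one_line n w ! j = xs ! j"
      by (auto simp: one_line_def w_def)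
  qed (simp add: one_line_def len)
  ultimately show "\<exists>w\<in>signed_perms n. xs = one_line n w" by metis
qed

section \<open>Standardization and pattern containment\<close>

text \<open>Ranks counted over positions can be compared between two words with different
  letters.\<close>

lemma rank_eq_card_indices:
  assumes "distinct as"
  shows "card {y \<in> set as. \<bar>y\<bar> \<le> c} = card {j. j < length as \<and> \<bar>as ! j\<bar> \<le> (c :: int)}"
proof -
  have "bij_betw ((!) as) {j. j < length as \<and> \<bar>as ! j\<bar> \<le> c} {y \<in> set as. \<bar>y\<bar> \<le> c}"
    using assms by (auto simp: bij_betw_def inj_on_def nth_eq_iff_index_eq in_set_conv_nth)
  then show ?thesis by (simp add: bij_betw_same_card)
qed

text \<open>Ranks preserve and reflect the order of absolute values, which gives one direction.
  Conversely, signs and comparisons determine all ranks, so \<open>as\<close> and \<open>u\<close>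
  have the same standardization, and that of \<open>u\<close> is \<open>u\<close>.\<close>

lemma sts_eq_iff:
  assumes dist: "distinct as" and nz: "0 \<notin> set as"
    and u: "distinct u" "sts u = u"
  shows "sts as = u \<longleftrightarrow> length as = length u \<and> (\<forall>i<length u. sgn (as ! i) = sgn (u ! i)) \<and>
    (\<forall>i<length u. \<forall>j<length u. \<bar>as ! i\<bar> \<le> \<bar>as ! j\<bar> \<longleftrightarrow> \<bar>u ! i\<bar> \<le> \<bar>u ! j\<bar>)"
proof
  assume sts: "sts as = u"
  define rank where "rank x = card {y \<in> set as. \<bar>y\<bar> \<le> \<bar>x\<bar>}" for x
  have len: "length as = length u" using sts by (auto simp: sts_def)
  have u_nth: "u ! i = sgn (as ! i) * int (rank (as ! i))" if "i < length u" for i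
  proof -
    have "sts as ! i = sgn (as ! i) * int (rank (as ! i))"
      unfolding sts_def rank_def using that len by simp
    then show ?thesis using sts by simp
  qed
  have rank_pos: "rank x > 0" if "x \<in> set as" for x
    unfolding rank_def card_gt_0_iff using that by auto
  have rank_mono: "rank x \<le> rank y \<longleftrightarrow> \<bar>x\<bar> \<le> \<bar>y\<bar>" if "x \<in> set as" "y \<in> set as" for x y
  proof (cases "\<bar>x\<bar> \<le> \<bar>y\<bar>")
    case True
    then show ?thesis unfolding rank_def by (auto intro!: card_mono)
  next
    case False
    then have "{z \<in> set as. \<bar>z\<bar> \<le> \<bar>y\<bar>} \<subset> {z \<in> set as. \<bar>z\<bar> \<le> \<bar>x\<bar>}"
      using that by force
    then have "rank y < rank x" unfolding rank_def by (intro psubset_card_mono) auto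
    then show ?thesis using False by simp
  qed
  have mem: "as ! i \<in> set as" "as ! i \<noteq> 0" if "i < length u" for i
  proof -
    show "as ! i \<in> set as" using that len by simp
    then show "as ! i \<noteq> 0" using nz by metis
  qed
  have "\<bar>u ! i\<bar> = int (rank (as ! i))" "sgn (u ! i) = sgn (as ! i)" if "i < length u" for i
    using u_nth[OF that] mem[OF that] rank_pos[of "as ! i"] by (auto simp: abs_mult sgn_mult)
  then show "length as = length u \<and> (\<forall>i<length u. sgn (as ! i) = sgn (u ! i)) \<and>
    (\<forall>i<length u. \<forall>j<length u. \<bar>as ! i\<bar> \<le> \<bar>as ! j\<bar> \<longleftrightarrow> \<bar>u ! i\<bar> \<le> \<bar>u ! j\<bar>)"
    using len mem rank_mono by simp
next
  assume *: "length as = length u \<and> (\<forall>i<length u. sgn (as ! i) = sgn (u ! i)) \<and>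
    (\<forall>i<length u. \<forall>j<length u. \<bar>as ! i\<bar> \<le> \<bar>as ! j\<bar> \<longleftrightarrow> \<bar>u ! i\<bar> \<le> \<bar>u ! j\<bar>)"
  have "sts as = sts u"
  proof (rule nth_equalityI)
    fix i assume "i < length (sts as)"
    then have i: "i < length u" using * by (simp add: sts_def)
    then have "{j. j < length as \<and> \<bar>as ! j\<bar> \<le> \<bar>as ! i\<bar>} = {j. j < length u \<and> \<bar>u ! j\<bar> \<le> \<bar>u ! i\<bar>}"
      using * by auto
    then show "sts as ! i = sts u ! i"
      using i * by (simp add: sts_def rank_eq_card_indices dist u(1))
  qed (use * in \<open>simp add: sts_def\<close>)
  then show "sts as = u" using u(2) by simp
qed

lemma contains_pattern_iff:
  assumes "distinct (map abs (one_line n w))" "0 \<notin> set (one_line n w)" "distinct u" "sts u = u"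
  shows "contains_pattern n w u \<longleftrightarrow> (\<exists>as. subseq as (one_line n w) \<and> length as = length u \<and>
    (\<forall>i<length u. sgn (as ! i) = sgn (u ! i)) \<and>
    (\<forall>i<length u. \<forall>j<length u. \<bar>as ! i\<bar> \<le> \<bar>as ! j\<bar> \<longleftrightarrow> \<bar>u ! i\<bar> \<le> \<bar>u ! j\<bar>))"
proof -
  have "sts as = u \<longleftrightarrow> length as = length u \<and> (\<forall>i<length u. sgn (as ! i) = sgn (u ! i)) \<and>
    (\<forall>i<length u. \<forall>j<length u. \<bar>as ! i\<bar> \<le> \<bar>as ! j\<bar> \<longleftrightarrow> \<bar>u ! i\<bar> \<le> \<bar>u ! j\<bar>)"
    if "subseq as (one_line n w)" for as
    by (rule sts_eq_iff)
      (use assms that subseq_set[OF that] in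
        \<open>auto simp: distinct_map dest: subseqs_distinctD[OF iffD2[OF in_set_subseqs]]\<close>)
  then show ?thesis unfolding contains_pattern_def by blast
qed

text \<open>Puts the sign condition on inversions into the form of a condition on subsequences of
  length 2, as for patterns.\<close>

lemma sorted_wrt_iff_subseq: "sorted_wrt P xs \<longleftrightarrow> (\<forall>a b. subseq [a, b] xs \<longrightarrow> P a b)"
proof (induction xs)
  case (Cons x xs)
  have "subseq [a, b] (x # xs) \<longleftrightarrow> a = x \<and> b \<in> set xs \<or> subseq [a, b] xs" for a b
    by (auto simp: list_emb_Cons_iff2 subseq_singleton_left dest: subseq_Cons')
  then show ?case using Cons by auto
qed simp

lemma ex_length_2:
  "(\<exists>as. P as \<and> length as = length [p, q] \<and> Q as) \<longleftrightarrow> (\<exists>a b. P [a, b] \<and> Q [a, b])"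
  by (auto simp: length_Suc_conv)

lemma ex_length_4:
  "(\<exists>as. P as \<and> length as = length [p, q, r, s] \<and> Q as) \<longleftrightarrow>
    (\<exists>a b c d. P [a, b, c, d] \<and> Q [a, b, c, d])"
  by (auto simp: length_Suc_conv)

text \<open>The two patterns of length 2 amount to the sign condition on inversions. Given that
  condition, an occurrence of 3142 or 2413 among the absolute values has constant sign and is thus
  one of the four patterns of length 4.\<close>

lemma one_line_mem_separable_words_iff:
  assumes w: "w \<in> signed_perms n"
  shows "one_line n w \<in> separable_words {-1, 1} n \<longleftrightarrow> w \<in> separable_signed_perms n"
proof -
  define xs where "xs = one_line n w"
  have dist: "distinct (map abs xs)" and img: "abs ` set xs = {1..int n}"
    using bij_betw_one_line[of n] w unfolding xs_def bij_betw_def by auto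
  have nz: "0 \<notin> set xs"
  proof
    assume "0 \<in> set xs"
    then have "\<bar>0\<bar> \<in> abs ` set xs" by (rule imageI)
    then show False using img by simp
  qed
  note contains = contains_pattern_iff[OF dist[unfolded xs_def] nz[unfolded xs_def], folded xs_def]
  have fixed: "sts [-2, 1] = [-2, 1]" "sts [2, -1] = [2, -1]"
    "sts [3, 1, 4, 2] = [3, 1, 4, 2]" "sts [2, 4, 1, 3] = [2, 4, 1, 3]"
    "sts [-3, -1, -4, -2] = [-3, -1, -4, -2]" "sts [-2, -4, -1, -3] = [-2, -4, -1, -3]"
    by code_simp+
  have neg_pos: "contains_pattern n w [-2, 1] \<longleftrightarrow> (\<exists>a b. subseq [a, b] xs \<and>
      (a < 0 \<and> b > 0) \<and> \<bar>b\<bar> < \<bar>a\<bar>)"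
    by (subst contains, simp, rule fixed(1), subst ex_length_2, intro ex_cong1 conj_cong refl)
      (auto simp: numeral_eq_Suc All_less_Suc sgn_1_pos sgn_1_neg)
  have pos_neg: "contains_pattern n w [2, -1] \<longleftrightarrow> (\<exists>a b. subseq [a, b] xs \<and>
      (a > 0 \<and> b < 0) \<and> \<bar>b\<bar> < \<bar>a\<bar>)"
    by (subst contains, simp, rule fixed(2), subst ex_length_2, intro ex_cong1 conj_cong refl)
      (auto simp: numeral_eq_Suc All_less_Suc sgn_1_pos sgn_1_neg)
  have p3142: "contains_pattern n w [3, 1, 4, 2] \<longleftrightarrow> (\<exists>a b c d. subseq [a, b, c, d] xs \<and>
      (a > 0 \<and> b > 0 \<and> c > 0 \<and> d > 0) \<and> \<bar>b\<bar> < \<bar>d\<bar> \<and> \<bar>d\<bar> < \<bar>a\<bar> \<and> \<bar>a\<bar> < \<bar>c\<bar>)"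
    by (subst contains, simp, rule fixed(3), subst ex_length_4, intro ex_cong1 conj_cong refl)
      (auto simp: numeral_eq_Suc All_less_Suc sgn_1_pos sgn_1_neg)
  have p2413: "contains_pattern n w [2, 4, 1, 3] \<longleftrightarrow> (\<exists>a b c d. subseq [a, b, c, d] xs \<and>
      (a > 0 \<and> b > 0 \<and> c > 0 \<and> d > 0) \<and> \<bar>c\<bar> < \<bar>a\<bar> \<and> \<bar>a\<bar> < \<bar>d\<bar> \<and> \<bar>d\<bar> < \<bar>b\<bar>)"
    by (subst contains, simp, rule fixed(4), subst ex_length_4, intro ex_cong1 conj_cong refl)
      (auto simp: numeral_eq_Suc All_less_Suc sgn_1_pos sgn_1_neg)
  have n3142: "contains_pattern n w [-3, -1, -4, -2] \<longleftrightarrow> (\<exists>a b c d. subseq [a, b, c, d] xs \<and>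
      (a < 0 \<and> b < 0 \<and> c < 0 \<and> d < 0) \<and> \<bar>b\<bar> < \<bar>d\<bar> \<and> \<bar>d\<bar> < \<bar>a\<bar> \<and> \<bar>a\<bar> < \<bar>c\<bar>)"
    by (subst contains, simp, rule fixed(5), subst ex_length_4, intro ex_cong1 conj_cong refl)
      (auto simp: numeral_eq_Suc All_less_Suc sgn_1_pos sgn_1_neg)
  have n2413: "contains_pattern n w [-2, -4, -1, -3] \<longleftrightarrow> (\<exists>a b c d. subseq [a, b, c, d] xs \<and>
      (a < 0 \<and> b < 0 \<and> c < 0 \<and> d < 0) \<and> \<bar>c\<bar> < \<bar>a\<bar> \<and> \<bar>a\<bar> < \<bar>d\<bar> \<and> \<bar>d\<bar> < \<bar>b\<bar>)"
    by (subst contains, simp, rule fixed(6), subst ex_length_4, intro ex_cong1 conj_cong refl)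
      (auto simp: numeral_eq_Suc All_less_Suc sgn_1_pos sgn_1_neg)
  have mem: "a \<in> set xs" if "subseq as xs" "a \<in> set as" for a as
    using subseq_set that by blast
  have sorted: "sorted_wrt (\<lambda>a b. \<bar>b\<bar> < \<bar>a\<bar> \<longrightarrow> sgn a = sgn b) xs \<longleftrightarrow>
      \<not> contains_pattern n w [-2, 1] \<and> \<not> contains_pattern n w [2, -1]"
  proof -
    have "(\<bar>b\<bar> < \<bar>a\<bar> \<longrightarrow> sgn a = sgn b) \<longleftrightarrow>
        \<not> ((a < 0 \<and> b > 0) \<and> \<bar>b\<bar> < \<bar>a\<bar>) \<and> \<not> ((a > 0 \<and> b < 0) \<and> \<bar>b\<bar> < \<bar>a\<bar>)"
      if "subseq [a, b] xs" for a b
    proof -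
      have "a \<noteq> 0" "b \<noteq> 0" using mem[OF that] nz by auto
      then show ?thesis by (auto simp: sgn_if)
    qed
    then show ?thesis unfolding sorted_wrt_iff_subseq neg_pos pos_neg by blast
  qed
  have avoids: "avoids abs xs \<longleftrightarrow>
      \<not> contains_pattern n w [3, 1, 4, 2] \<and> \<not> contains_pattern n w [2, 4, 1, 3] \<and>
      \<not> contains_pattern n w [-3, -1, -4, -2] \<and> \<not> contains_pattern n w [-2, -4, -1, -3]"
    if sw: "sorted_wrt (\<lambda>a b. \<bar>b\<bar> < \<bar>a\<bar> \<longrightarrow> sgn a = sgn b) xs"
  proof -
    have same: "(a > 0 \<and> b > 0 \<and> c > 0 \<and> d > 0) \<or> (a < 0 \<and> b < 0 \<and> c < 0 \<and> d < 0)"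
      if sub: "subseq [a, b, c, d] xs" and order: "\<bar>b\<bar> < \<bar>d\<bar> \<and> \<bar>d\<bar> < \<bar>a\<bar> \<and> \<bar>a\<bar> < \<bar>c\<bar> \<or>
        \<bar>c\<bar> < \<bar>a\<bar> \<and> \<bar>a\<bar> < \<bar>d\<bar> \<and> \<bar>d\<bar> < \<bar>b\<bar>" for a b c d
    proof -
      have pair: "\<bar>y\<bar> < \<bar>x\<bar> \<longrightarrow> sgn x = sgn y" if "subseq [x, y] [a, b, c, d]" for x y
        using sw sub subseq_order.trans[OF that] unfolding sorted_wrt_iff_subseq by blast
      \<comment> \<open>The first three pairs are the inversions of 3142, the last three those of
        2413. In either case they link all four letters in a path, so the signs agree.\<close>
      have "\<bar>b\<bar> < \<bar>a\<bar> \<longrightarrow> sgn a = sgn b" "\<bar>d\<bar> < \<bar>a\<bar> \<longrightarrow> sgn a = sgn d" "\<bar>d\<bar> < \<bar>c\<bar> \<longrightarrow> sgn c = sgn d"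
        "\<bar>c\<bar> < \<bar>a\<bar> \<longrightarrow> sgn a = sgn c" "\<bar>c\<bar> < \<bar>b\<bar> \<longrightarrow> sgn b = sgn c" "\<bar>d\<bar> < \<bar>b\<bar> \<longrightarrow> sgn b = sgn d"
        by (rule pair; simp add: list_emb_Cons_iff2)+
      then have "sgn a = sgn b \<and> sgn b = sgn c \<and> sgn c = sgn d"
        using order by (smt (verit))
      moreover have "a \<noteq> 0" using mem[OF sub, of a] nz by auto
      ultimately show ?thesis by (auto simp: sgn_if split: if_splits)
    qed
    show ?thesis
      unfolding avoids_def p3142 p2413 n3142 n2413 using same by blast
  qed
  have signs: "sgn ` set xs \<subseteq> {-1, 1}"
    using nz by (auto simp: sgn_if)
  have "one_line n w \<in> separable_words {-1, 1} n \<longleftrightarrow>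
      sorted_wrt (\<lambda>a b. \<bar>b\<bar> < \<bar>a\<bar> \<longrightarrow> sgn a = sgn b) xs \<and> avoids abs xs"
    using dist img signs unfolding separable_words_def xs_def by simp
  also have "\<dots> \<longleftrightarrow> w \<in> separable_signed_perms n"
    using w sorted avoids unfolding separable_signed_perms_def by auto
  finally show ?thesis .
qed

theorem corollary4p4:
  fixes n :: nat
  shows "card (separable_signed_perms n) = large_schroeder n"
proof -
  have "bij_betw (one_line n) (separable_signed_perms n) (separable_words {-1, 1} n)"
  proof -
    \<comment> \<open>Surjectivity: every separable word is the one-line notation of some signed
      permutation.\<close>
    have "separable_words {-1, 1} n \<subseteq> one_line n ` signed_perms n"
      using bij_betw_one_line[of n] unfolding bij_betw_def separable_words_def by auto
    then have "one_line n ` separable_signed_perms n = separable_words {-1, 1} n"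
      using one_line_mem_separable_words_iff unfolding separable_signed_perms_def by blast
    then show ?thesis
      using bij_betw_one_line[of n] unfolding bij_betw_def separable_signed_perms_def
      by (auto intro: inj_on_subset)
  qed
  then show ?thesis
    using card_separable_words_eq_large_schroeder by (simp add: bij_betw_same_card)
qed

end
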